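(* Let $n$ be a positive integer coprime to $3$. Then, with $x=t+t^{-1}$, $$\Delta_{n,3}(t)=V_{n-1}(x)+\sum_{k=0}^{d}\bigl(-V_{n-2-3k}(x)-V_{n-3-3k}(x)+2V_{n-4-3k}(x)\bigr)=\sum_{j=0}^{d_1}\widetilde V_{n-1-3j}(x)-\sum_{i=0}^{d_2}\widetilde V_{n-5-3i}(x),$$ where $d=\left[\frac{n-2}{3}\right]$, $d_1=\left[\frac{n-1}{3}\right]$, $d_2=\left[\frac{n-5}{3}\right]$.
   Context: For coprime positive integers $n,l$, $\Delta_{n,l}(t)$ denotes the Alexander polynomial of the torus knot $T(n,l)$, normalized by the skein relation $\Delta_{+}(t)=(t^{1/2}-t^{-1/2})\Delta_{O}(t)+\Delta_{-}(t)$ together with $\Delta_{\rm unknot}=1$. It is the Laurent polynomial in $t$ given by the known formula $$\Delta_{n,l}(t)=\frac{(t^{nl/2}-t^{-nl/2})(t^{1/2}-t^{-1/2})}{(t^{n/2}-t^{-n/2})(t^{l/2}-t^{-l/2})};$$ for $n$ coprime to $3$, $\Delta_{n,3}(t)=\dfrac{t^{n}+1+t^{-n}}{t+1+t^{-1}}$. The monic Chebyshev polynomials of the second kind $V_k(x)$ are defined for $k\ge 0$ by $V_0=1$, $V_1=x$, $V_{k+1}=xV_k-V_{k-1}$ (equivalently $V_k(x)=\sin((k+1)\theta)/\sin\theta$ with $2\cos\theta=x$); by convention $V_k=0$ for every $k<0$. For $k\ge 0$, $$\widetilde V_k(x)=\sum_{j=1}^{k+1}(-1)^{[j/2]}\,V_{k+1-j}(x)=V_k-V_{k-1}-V_{k-2}+V_{k-3}+V_{k-4}-\cdots.$$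 Here $[y]$ denotes the integer part (floor) of $y$, and a sum from $0$ to a negative upper limit is empty, hence $0$. *)

theory Defs
  imports "HOL-Computational_Algebra.Formal_Laurent_Series"
begin

text \<open>
  Laurent polynomials in \<open>t\<^sup>1\<^sup>/\<^sup>2\<close> are regarded as elements of the field \<open>\<rat>((t\<^sup>1\<^sup>/\<^sup>2))\<close>, so that
  quotients make sense: the formal variable of \<^typ>\<open>rat fls\<close> plays the role of \<open>t\<^sup>1\<^sup>/\<^sup>2\<close>, not of \<open>t\<close>.
\<close>

definition sqrt_t :: "rat fls" where
  "sqrt_t = fls_X"

definition t_var :: "rat fls" where
  "t_var = sqrt_t ^ 2"

text \<open>
  The Alexander polynomial of the torus knot \<open>T(n,l)\<close> (for coprime positive \<open>n\<close> and \<open>l\<close>), given by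
  its known closed form in the skein normalization
  \<open>\<Delta>\<^sub>+ = (t\<^sup>1\<^sup>/\<^sup>2 - t\<^sup>-\<^sup>1\<^sup>/\<^sup>2) \<Delta>\<^sub>O + \<Delta>\<^sub>-\<close>, \<open>\<Delta>(unknot) = 1\<close>.
\<close>

definition torus_alexander :: "nat \<Rightarrow> nat \<Rightarrow> rat fls" where
  "torus_alexander n l =
     ((sqrt_t powi (int n * int l) - sqrt_t powi (- (int n * int l))) * (sqrt_t powi 1 - sqrt_t powi (- 1))) /
     ((sqrt_t powi (int n) - sqrt_t powi (- int n)) * (sqrt_t powi (int l) - sqrt_t powi (- int l)))"

fun cheb_V_nat :: "nat \<Rightarrow> 'a::comm_ring_1 poly" where
  "cheb_V_nat 0 = 1"
| "cheb_V_nat (Suc 0) = [:0, 1:]"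
| "cheb_V_nat (Suc (Suc k)) = [:0, 1:] * cheb_V_nat (Suc k) - cheb_V_nat k"

text \<open>Monic Chebyshev polynomials of the second kind, extended by zero to negative indices.\<close>

definition cheb_V :: "int \<Rightarrow> 'a::comm_ring_1 poly" where
  "cheb_V k = (if k < 0 then 0 else cheb_V_nat (nat k))"

text \<open>Only used for \<open>k \<ge> 0\<close>; the sum is empty for negative \<open>k\<close>.\<close>

definition cheb_V_tilde :: "int \<Rightarrow> 'a::comm_ring_1 poly" where
  "cheb_V_tilde k = (\<Sum>j = 1..k + 1. (- 1) ^ nat (j div 2) * cheb_V (k + 1 - j))"

end

theory Submission
  imports Defs
begin

text \<open>
  Write \<open>V\<^sub>k\<close> for \<open>V\<^sub>k(x)\<close> and put \<open>D m = V\<^sub>m - V\<^sub>m\<^sub>-\<^sub>1 - V\<^sub>m\<^sub>-\<^sub>2 + V\<^sub>m\<^sub>-\<^sub>3\<close>. All three expressions in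
  the theorem are the sum of \<open>D\<close> over \<open>n - 1, n - 4, n - 7, \<dots>\<close>, continued as long as the index is
  nonnegative.

  For the Alexander polynomial this is a telescoping sum. As \<open>V\<^sub>m - V\<^sub>m\<^sub>-\<^sub>2 = t\<^sup>m + t\<^sup>-\<^sup>m\<close> for \<open>m > 0\<close>,
  one finds \<open>D m = (t\<^sup>m + t\<^sup>-\<^sup>m) - (t\<^sup>m\<^sup>-\<^sup>1 + t\<^sup>1\<^sup>-\<^sup>m)\<close> for \<open>m \<ge> 2\<close>, and multiplication by \<open>t + 1 + t\<^sup>-\<^sup>1\<close>
  gives the difference of the values of \<open>t\<^sup>n + 1 + t\<^sup>-\<^sup>n\<close> at \<open>n = m + 1\<close> and \<open>n = m - 2\<close>. The
  coprimality of \<open>n\<close> and \<open>3\<close> enters through the last term of the sum: it is \<open>D 0 = 1\<close> or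
  \<open>D 1 = x - 1\<close>, which are \<open>\<Delta>\<^sub>1\<^sub>,\<^sub>3\<close> and \<open>\<Delta>\<^sub>2\<^sub>,\<^sub>3\<close> (lemma \<open>step3_sum_cheb_D\<close>).

  The two Chebyshev expressions arise from two ways to collect the terms of \<open>D\<close>. Either all terms
  with index at most \<open>n - 2\<close> are grouped in threes, where \<open>V\<^sub>n\<^sub>-\<^sub>4\<^sub>-\<^sub>3\<^sub>k\<close> occurs twice, or one uses
  \<open>D m = T m - T (m - 4)\<close> with \<open>T\<close> the alternating sum \<open>cheb_V_tilde\<close>, whose sign pattern has
  period \<open>4\<close>. Both regroupings are verified without tracking the summation bounds: each side vanishes
  at negative indices and satisfies the same recurrence in steps of three, which determines it
  (lemma \<open>step3_sum_unique\<close>).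
\<close>

section \<open>Sums in steps of three\<close>

definition step3_sum :: "(int \<Rightarrow> 'a::comm_monoid_add) \<Rightarrow> int \<Rightarrow> 'a" where
  "step3_sum f m = (\<Sum>k = 0..m div 3. f (m - 3 * k))"

lemma step3_sum_neg: "m < 0 \<Longrightarrow> step3_sum f m = 0"
  by (simp add: step3_sum_def)

lemma step3_sum_rec:
  assumes "m \<ge> 0"
  shows "step3_sum f m = f m + step3_sum f (m - 3)"
proof -
  have split: "{0..m div 3} = insert 0 {1..m div 3}"
    using assms by auto
  have "(\<Sum>k = 1..m div 3. f (m - 3 * k)) = (\<Sum>k = 0..(m - 3) div 3. f (m - 3 - 3 * k))"
    by (rule sum.reindex_bij_witness[of _ "\<lambda>k. k + 1" "\<lambda>k. k - 1"]) (auto simp: algebra_simps)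
  then show ?thesis
    unfolding step3_sum_def split by simp
qed

lemma step3_sum_unique:
  fixes F :: "int \<Rightarrow> 'a::comm_monoid_add"
  assumes neg: "\<And>m. m < 0 \<Longrightarrow> F m = 0"
    and rec: "\<And>m. m \<ge> 0 \<Longrightarrow> F m = f m + F (m - 3)"
  shows "F m = step3_sum f m"
proof (induction m rule: measure_induct_rule[where f = "\<lambda>m. nat (m + 3)"])
  case (less m)
  show ?case
  proof (cases "m < 0")
    case True
    then show ?thesis by (simp add: neg step3_sum_neg)
  next
    case False
    then show ?thesis using less[of "m - 3"] by (simp add: rec step3_sum_rec)
  qed
qed

text \<open>The regroupings below shift indices by amounts that can carry them below zero. There the
  convention that the Chebyshev polynomials vanish keeps the recurrence valid.\<close>

lemma step3_sum_rec_vanishing: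
  assumes "\<And>m. m < 0 \<Longrightarrow> f m = 0"
  shows "step3_sum f m = f m + step3_sum f (m - 3)"
  using assms by (cases "m < 0") (simp_all add: step3_sum_neg step3_sum_rec)

section \<open>Regrouping the Chebyshev sums\<close>

lemma cheb_V_neg: "k < 0 \<Longrightarrow> cheb_V k = 0"
  by (simp add: cheb_V_def)

lemma cheb_V_tilde_neg: "k < 0 \<Longrightarrow> cheb_V_tilde k = 0"
  by (simp add: cheb_V_tilde_def)

definition cheb_D :: "int \<Rightarrow> 'a::comm_ring_1 poly" where
  "cheb_D m = cheb_V m - cheb_V (m - 1) - cheb_V (m - 2) + cheb_V (m - 3)"

text \<open>The sign \<open>(- 1) ^ (j div 2)\<close> is unchanged when \<open>j\<close> grows by \<open>4\<close>, so after its four leading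
  terms the alternating sum repeats itself. For \<open>k < 3\<close> some of these four terms are absent from
  the sum, but then they have negative index; this is why the proof extends the range to \<open>N\<close>.\<close>

lemma cheb_D_eq_tilde_diff:
  "cheb_D k = (cheb_V_tilde k - cheb_V_tilde (k - 4) :: 'a::comm_ring_1 poly)"
proof -
  define g :: "int \<Rightarrow> 'a poly" where "g j = (- 1) ^ nat (j div 2) * cheb_V (k + 1 - j)" for j
  define N where "N = max (k + 1) 4"
  have "cheb_V_tilde k = (\<Sum>j = 1..N. g j)"
    unfolding cheb_V_tilde_def g_def
    by (rule sum.mono_neutral_left) (auto simp: N_def cheb_V_neg)
  also have "{1..N} = {1, 2, 3, 4} \<union> {5..N}"
    by (auto simp: N_def)
  also have "sum g \<dots> = cheb_D k + (\<Sum>j = 5..N. g j)"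
    by (subst sum.union_disjoint) (auto simp: g_def cheb_D_def algebra_simps)
  also have "(\<Sum>j = 5..N. g j) = cheb_V_tilde (k - 4)"
    unfolding cheb_V_tilde_def
  proof (rule sum.reindex_bij_witness[of _ "\<lambda>j. j + 4" "\<lambda>j. j - 4"])
    fix j assume "j \<in> {5..N}"
    then have "nat (j div 2) = nat ((j - 4) div 2) + 2"
      by auto
    then show "(- 1) ^ nat ((j - 4) div 2) * cheb_V (k - 4 + 1 - (j - 4)) = g j"
      by (simp add: g_def algebra_simps)
  qed (auto simp: N_def)
  finally show ?thesis by simp
qed

lemma step3_sum_cheb_V_grouped:
  fixes x :: "'a::comm_ring_1"
  shows "poly (cheb_V m) x
      + step3_sum (\<lambda>j. - poly (cheb_V j) x - poly (cheb_V (j - 1)) x + 2 * poly (cheb_V (j - 2)) x)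
          (m - 1)
    = step3_sum (\<lambda>j. poly (cheb_D j) x) m"
    (is "_ + step3_sum ?E (m - 1) = _")
proof (rule step3_sum_unique[where F = "\<lambda>m. poly (cheb_V m) x + step3_sum ?E (m - 1)"])
  fix m :: int
  assume "m \<ge> 0"
  have "step3_sum ?E (m - 1) = ?E (m - 1) + step3_sum ?E (m - 1 - 3)"
    by (rule step3_sum_rec_vanishing) (simp add: cheb_V_neg)
  then show "poly (cheb_V m) x + step3_sum ?E (m - 1)
      = poly (cheb_D m) x + (poly (cheb_V (m - 3)) x + step3_sum ?E (m - 3 - 1))"
    by (simp add: cheb_D_def algebra_simps)
qed (simp add: cheb_V_neg step3_sum_neg)

lemma step3_sum_cheb_V_tilde:
  fixes x :: "'a::comm_ring_1"
  shows "step3_sum (\<lambda>j. poly (cheb_V_tilde j) x) m - step3_sum (\<lambda>j. poly (cheb_V_tilde j) x) (m - 4)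
    = step3_sum (\<lambda>j. poly (cheb_D j) x) m"
    (is "step3_sum ?T m - _ = _")
proof (rule step3_sum_unique[where F = "\<lambda>m. step3_sum ?T m - step3_sum ?T (m - 4)"])
  fix m :: int
  assume "m \<ge> 0"
  have rec: "step3_sum ?T j = ?T j + step3_sum ?T (j - 3)" for j
    by (rule step3_sum_rec_vanishing) (simp add: cheb_V_tilde_neg)
  show "step3_sum ?T m - step3_sum ?T (m - 4)
      = poly (cheb_D m) x + (step3_sum ?T (m - 3) - step3_sum ?T (m - 3 - 4))"
    using rec[of m] rec[of "m - 4"] by (simp add: cheb_D_eq_tilde_diff)
qed (simp add: step3_sum_neg)

section \<open>The telescoping sum\<close>

lemma poly_cheb_V_nat_diff:
  fixes t :: "'a::field"
  assumes "t \<noteq> 0"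
  shows "poly (cheb_V_nat (Suc (Suc k))) (t + inverse t) - poly (cheb_V_nat k) (t + inverse t)
    = t ^ (k + 2) + inverse t ^ (k + 2)"
proof (induction k rule: cheb_V_nat.induct)
  case (3 k)
  let ?x = "t + inverse t"
  let ?V = "\<lambda>k. poly (cheb_V_nat k) ?x"
  have V: "?V (Suc (Suc j)) = ?x * ?V (Suc j) - ?V j" for j
    by simp
  have "?V (k + 4) - ?V (k + 2) = ?x * (?V (k + 3) - ?V (k + 1)) - (?V (k + 2) - ?V k)"
    using V[of "k + 2"] V[of k] by (simp add: eval_nat_numeral algebra_simps del: cheb_V_nat.simps)
  also have "\<dots> = ?x * (t ^ (k + 3) + inverse t ^ (k + 3)) - (t ^ (k + 2) + inverse t ^ (k + 2))"
    using 3 by (simp add: eval_nat_numeral del: cheb_V_nat.simps power_Suc)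
  also have "\<dots> = t ^ (k + 4) + inverse t ^ (k + 4)"
    using assms by (simp add: field_simps eval_nat_numeral)
  finally show ?case
    by (simp add: eval_nat_numeral del: cheb_V_nat.simps power_Suc)
qed (use assms in \<open>simp_all add: field_simps eval_nat_numeral\<close>)

text \<open>At \<open>m = 1\<close> this rests on the convention \<open>V\<^sub>-\<^sub>1 = 0\<close>. At \<open>m = 0\<close> it fails: the left side is \<open>1\<close>
  and the right side \<open>2\<close>.\<close>

lemma poly_cheb_V_diff:
  fixes t :: "'a::field"
  assumes "t \<noteq> 0" and "m > 0"
  shows "poly (cheb_V m) (t + inverse t) - poly (cheb_V (m - 2)) (t + inverse t)
    = t powi m + inverse t powi m"
proof (cases "m = 1")
  case True
  then show ?thesis by (simp add: cheb_V_def)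
next
  case False
  define k where "k = nat (m - 2)"
  have m: "m = int (k + 2)"
    using False assms(2) by (simp add: k_def)
  show ?thesis
    using poly_cheb_V_nat_diff[OF assms(1), of k]
    unfolding m power_int_of_nat by (simp add: cheb_V_def nat_add_distrib eval_nat_numeral)
qed

text \<open>The induction step is the identity
  \<open>(t\<^sup>2 u - t u) (t + 1 + t\<^sup>-\<^sup>1) = t\<^sup>3 u - u\<close> for \<open>u = t\<^sup>m\<^sup>-\<^sup>2\<close>, together with its mirror image
  under \<open>t \<mapsto> t\<^sup>-\<^sup>1\<close>. In the residue class \<open>m mod 3 = 2\<close> the descent ends at \<open>m = -1\<close>,
  where the left side is \<open>0\<close> and the right side \<open>3\<close>, so the two sides differ by \<open>3\<close> throughout.\<close>

lemma step3_sum_cheb_D: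
  fixes t :: "'a::field"
  assumes "t \<noteq> 0" and "m \<ge> 0" and "m mod 3 \<noteq> 2"
  shows "step3_sum (\<lambda>j. poly (cheb_D j) (t + inverse t)) m * (t + 1 + inverse t)
    = t powi (m + 1) + 1 + inverse t powi (m + 1)"
  using assms(2,3)
proof (induction m rule: measure_induct_rule[where f = nat])
  case (less m)
  let ?D = "\<lambda>j. poly (cheb_D j) (t + inverse t)"
  consider "m = 0" | "m = 1" | "m \<ge> 3"
    using less.prems by fastforce
  then show ?case
  proof cases
    case 1
    then show ?thesis by (simp add: step3_sum_def cheb_D_def cheb_V_def)
  next
    case 2
    then show ?thesis
      using assms(1) by (simp add: step3_sum_def cheb_D_def cheb_V_def field_simps power2_eq_square)
  next
    case 3
    have IH: "step3_sum ?D (m - 3) * (t + 1 + inverse t)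
        = t powi (m - 2) + 1 + inverse t powi (m - 2)"
      using less.IH[of "m - 3"] less.prems 3 by (simp add: mod_diff_eq[symmetric])
    have D: "?D m = (t powi m + inverse t powi m) - (t powi (m - 1) + inverse t powi (m - 1))"
      using poly_cheb_V_diff[OF assms(1), of m] poly_cheb_V_diff[OF assms(1), of "m - 1"] 3
      by (simp add: cheb_D_def algebra_simps)
    define u where "u = t powi (m - 2)"
    define v where "v = inverse t powi (m - 2)"
    have tpow: "s powi (m - 1) = s * s powi (m - 2)" "s powi m = s ^ 2 * s powi (m - 2)"
      "s powi (m + 1) = s ^ 3 * s powi (m - 2)" if "s \<noteq> 0" for s :: 'a
      using power_int_add[OF disjI1[OF that], of 1 "m - 2"]
        power_int_add[OF disjI1[OF that], of 2 "m - 2"]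
        power_int_add[OF disjI1[OF that], of 3 "m - 2"]
      by (simp_all add: add.commute)
    have "t * inverse t = 1"
      using assms(1) by simp
    then have "(t\<^sup>2 * u + (inverse t)\<^sup>2 * v - (t * u + inverse t * v)) * (t + 1 + inverse t)
        + (u + 1 + v) = t ^ 3 * u + 1 + inverse t ^ 3 * v"
      by algebra
    moreover have "step3_sum ?D m = ?D m + step3_sum ?D (m - 3)"
      using 3 by (simp add: step3_sum_rec)
    ultimately show ?thesis
      using IH assms(1) by (simp add: D tpow distrib_right u_def v_def)
  qed
qed

section \<open>The Alexander polynomial\<close>

text \<open>This makes the division in \<open>torus_alexander\<close> a true one: the two powers have different orders of
  vanishing at \<open>0\<close>.\<close>

lemma sqrt_t_powi_diff_nonzero:
  assumes "n > 0"
  shows "sqrt_t powi int n - sqrt_t powi - int n \<noteq> 0"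
proof
  assume "sqrt_t powi int n - sqrt_t powi - int n = 0"
  then have "fls_subdegree (sqrt_t powi int n) = fls_subdegree (sqrt_t powi - int n)"
    by simp
  with assms show False
    by (simp add: sqrt_t_def power_int_minus fls_subdegree_pow)
qed

lemma sqrt_t_cube_diff:
  "sqrt_t ^ 3 - inverse sqrt_t ^ 3 = (t_var + 1 + inverse t_var) * (sqrt_t - inverse sqrt_t)"
proof -
  have "sqrt_t * inverse sqrt_t = 1"
    by (simp add: sqrt_t_def)
  then show ?thesis
    unfolding t_var_def power_inverse[symmetric] by algebra
qed

lemma sqrt_t_cube_diff_nonzero: "sqrt_t ^ 3 - inverse sqrt_t ^ 3 \<noteq> 0"
  using sqrt_t_powi_diff_nonzero[of 3] by (simp add: power_int_minus power_inverse)

lemma t_var_denominator_nonzero: "t_var + 1 + inverse t_var \<noteq> 0"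
  using sqrt_t_cube_diff_nonzero by (auto simp: sqrt_t_cube_diff)

lemma torus_alexander_3:
  assumes "n > 0"
  shows "torus_alexander n 3 * (t_var + 1 + inverse t_var)
      = t_var powi int n + 1 + inverse t_var powi int n"
proof -
  define s where "s = sqrt_t"
  define a b where "a = s ^ n" and "b = inverse s ^ n"
  have s0: "s \<noteq> 0"
    by (simp add: s_def sqrt_t_def)
  have ab: "a * b = 1"
    using s0 by (simp add: a_def b_def power_mult_distrib[symmetric])
  have nz: "a - b \<noteq> 0" "s ^ 3 - inverse s ^ 3 \<noteq> 0"
    using sqrt_t_powi_diff_nonzero[OF assms] sqrt_t_cube_diff_nonzero
    by (simp_all add: a_def b_def s_def power_int_minus power_inverse)
  have "s powi (int n * 3) = a ^ 3"
    by (simp add: a_def power_int_mult)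
  then have "torus_alexander n 3 = ((a ^ 3 - b ^ 3) * (s - inverse s))
      / ((a - b) * (s ^ 3 - inverse s ^ 3))"
    by (simp add: torus_alexander_def s_def[symmetric] a_def b_def power_int_minus power_inverse)
  moreover have "a ^ 3 - b ^ 3 = (a - b) * (a\<^sup>2 + 1 + b\<^sup>2)"
    using ab by algebra
  ultimately have "torus_alexander n 3 * (s ^ 3 - inverse s ^ 3) = (a\<^sup>2 + 1 + b\<^sup>2) * (s - inverse s)"
    using nz by simp
  then have "(torus_alexander n 3 * (t_var + 1 + inverse t_var)) * (s - inverse s)
      = (a\<^sup>2 + 1 + b\<^sup>2) * (s - inverse s)"
    by (simp add: s_def sqrt_t_cube_diff mult.assoc)
  moreover have "s - inverse s \<noteq> 0"
    using nz(2) by (auto simp: s_def sqrt_t_cube_diff)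
  ultimately have "torus_alexander n 3 * (t_var + 1 + inverse t_var) = a\<^sup>2 + 1 + b\<^sup>2"
    by simp
  then show ?thesis
    by (simp add: t_var_def s_def[symmetric] a_def b_def power_inverse power_mult[symmetric]
        mult.commute)
qed

lemma floor_diff_div_3: "\<lfloor>(rat_of_nat n - of_int a) / 3\<rfloor> = (int n - a) div 3"
  using floor_divide_of_int_eq[of "int n - a" 3, where 'a = rat] by simp

theorem mainTheorem4:
  fixes n :: nat and d d1 d2 :: int and x :: "rat fls"
  assumes "n > 0" and "coprime n 3"
    and "x = t_var + inverse t_var"
    and "d = \<lfloor>(rat_of_nat n - 2) / 3\<rfloor>"
    and "d1 = \<lfloor>(rat_of_nat n - 1) / 3\<rfloor>"
    and "d2 = \<lfloor>(rat_of_nat n - 5) / 3\<rfloor>"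
  shows "torus_alexander n 3 =
           poly (cheb_V (int n - 1)) x
           + (\<Sum>k = 0..d. - poly (cheb_V (int n - 2 - 3 * k)) x
                          - poly (cheb_V (int n - 3 - 3 * k)) x
                          + 2 * poly (cheb_V (int n - 4 - 3 * k)) x)
       \<and> poly (cheb_V (int n - 1)) x
           + (\<Sum>k = 0..d. - poly (cheb_V (int n - 2 - 3 * k)) x
                          - poly (cheb_V (int n - 3 - 3 * k)) x
                          + 2 * poly (cheb_V (int n - 4 - 3 * k)) x)
         = (\<Sum>j = 0..d1. poly (cheb_V_tilde (int n - 1 - 3 * j)) x)
           - (\<Sum>i = 0..d2. poly (cheb_V_tilde (int n - 5 - 3 * i)) x)"
    (is "_ = ?A \<and> ?A = ?B")
proof -
  let ?S = "step3_sum (\<lambda>j. poly (cheb_D j) x) (int n - 1)"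
  have d: "d = (int n - 2) div 3" "d1 = (int n - 1) div 3" "d2 = (int n - 5) div 3"
    using floor_diff_div_3[of n 2] floor_diff_div_3[of n 1] floor_diff_div_3[of n 5] assms(4-6)
    by simp_all
  have A: "?A = ?S"
    using step3_sum_cheb_V_grouped[of "int n - 1" x]
    by (simp add: step3_sum_def d algebra_simps)
  have B: "?B = ?S"
    using step3_sum_cheb_V_tilde[of x "int n - 1"]
    by (simp add: step3_sum_def d)
  have t0: "t_var \<noteq> 0"
    by (simp add: t_var_def sqrt_t_def)
  have "\<not> 3 dvd n"
    using assms(2) by (auto dest: coprime_common_divisor_nat)
  then have "(int n - 1) mod 3 \<noteq> 2"
    by presburger
  then have "?S * (t_var + 1 + inverse t_var) = t_var powi int n + 1 + inverse t_var powi int n"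
    using step3_sum_cheb_D[OF t0, of "int n - 1"] assms(1) by (simp add: assms(3))
  then have "torus_alexander n 3 * (t_var + 1 + inverse t_var) = ?S * (t_var + 1 + inverse t_var)"
    by (simp add: torus_alexander_3[OF assms(1)])
  then have "torus_alexander n 3 = ?S"
    using t_var_denominator_nonzero by simp
  with A B show ?thesis by simp
qed

end
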